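(* Let $f_\theta:\mathbb{R}^d\to\mathbb{R}^K$ be a classifier, let $x\in\mathbb{R}^d$ be an input, and let $x^\ast = x+\delta\in\mathbb{R}^d$ be a perturbed counterpart of $x$, with $\delta\in\Delta=\{\delta\in\mathbb{R}^d:\|\delta\|_p\le\epsilon\}$. Let $p(y\mid x)$ and $p(y\mid x^\ast)$ be the discrete (softmax) distributions over the classes $\{1,\dots,K\}$ that the classifier assigns to $x$ and $x^\ast$, and let $E_\theta(\cdot)$ and $E_\theta(\cdot,\cdot)$ be the marginal and joint energies associated with $f_\theta$. Then $$\mathrm{KL}\big(p(y\mid x)\,\big\|\,p(y\mid x^\ast)\big)=\mathbb{E}_{k\sim p(y\mid x)}\Big[E_\theta(x^\ast,k)-E_\theta(x,k)\Big]+E_\theta(x)-E_\theta(x^\ast).$$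
   Context: For a classifier $f_\theta:\mathbb{R}^d\to\mathbb{R}^K$ (with parameters $\theta$), $f_\theta(x)[k]$ denotes the $k$-th logit, i.e. the $k$-th coordinate of $f_\theta(x)$. The classifier's conditional distribution over the classes $\{1,\dots,K\}$ is the softmax $$p(y\mid x)=p_\theta(y\mid x)=\frac{\exp(f_\theta(x)[y])}{\sum_{k=1}^K\exp(f_\theta(x)[k])}.$$ The joint energy is $E_\theta(x,y)=-\log\exp(f_\theta(x)[y])=-f_\theta(x)[y]$ for $y\in\{1,\dots,K\}$, and the marginal energy is $E_\theta(x)=-\log\sum_{k=1}^K\exp(f_\theta(x)[k])$. For two distributions $p,q$ on $\{1,\dots,K\}$ with $q$ everywhere positive, $\mathrm{KL}(p\|q)=\sum_{k=1}^K p(k)\log\frac{p(k)}{q(k)}$ (natural logarithm). The notation $\mathbb{E}_{k\sim p(y\mid x)}[g(k)]$ means $\sum_{k=1}^K p(k\mid x)\,g(k)$. Here $\|\cdot\|_p$ is an $\ell_p$ norm on $\mathbb{R}^d$ and $\epsilon$ is the perturbation budget. *)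

theory Defs
  imports "HOL-Analysis.Analysis"
begin

text \<open>
  A classifier is a map \<open>f :: real ^ 'd \<Rightarrow> real ^ 'k\<close> (the parameters are absorbed in \<open>f\<close>); the
  classes \<open>1, \<dots>, K\<close> are the elements of the finite index type \<open>'k\<close>, so \<open>K = CARD('k)\<close>.
\<close>

definition class_prob :: "(real ^ 'd \<Rightarrow> real ^ 'k) \<Rightarrow> real ^ 'd \<Rightarrow> 'k \<Rightarrow> real" where
  "class_prob f x y = exp (f x $ y) / (\<Sum>k\<in>UNIV. exp (f x $ k))"

definition joint_energy :: "(real ^ 'd \<Rightarrow> real ^ 'k) \<Rightarrow> real ^ 'd \<Rightarrow> 'k \<Rightarrow> real" where
  "joint_energy f x y = - ln (exp (f x $ y))"

definition marginal_energy :: "(real ^ 'd \<Rightarrow> real ^ 'k) \<Rightarrow> real ^ 'd \<Rightarrow> real" where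
  "marginal_energy f x = - ln (\<Sum>k\<in>UNIV. exp (f x $ k))"

text \<open>
  Distributions on the classes are given by their mass functions. In \<open>KL_div p q\<close> the second
  argument is meant to be everywhere positive, which holds for \<open>class_prob\<close>.
\<close>

definition KL_div :: "('k::finite \<Rightarrow> real) \<Rightarrow> ('k \<Rightarrow> real) \<Rightarrow> real" where
  "KL_div p q = (\<Sum>k\<in>UNIV. p k * ln (p k / q k))"

definition class_expectation :: "('k::finite \<Rightarrow> real) \<Rightarrow> ('k \<Rightarrow> real) \<Rightarrow> real" where
  "class_expectation p g = (\<Sum>k\<in>UNIV. p k * g k)"

lemma class_prob_pos: "class_prob f x y > 0"
  unfolding class_prob_def by (intro divide_pos_pos sum_pos) auto

lemma sum_class_prob: "(\<Sum>y\<in>UNIV. class_prob f x y) = 1"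
proof -
  have "(\<Sum>k\<in>UNIV. exp (f x $ k)) > 0"
    by (intro sum_pos) auto
  then show ?thesis
    by (simp add: class_prob_def flip: sum_divide_distrib)
qed

text \<open>The exponent ranges over \<open>1 \<le> p \<le> \<infinity>\<close>; outside this range the value is irrelevant.\<close>

definition lp_norm :: "ereal \<Rightarrow> real ^ 'd \<Rightarrow> real" where
  "lp_norm p v =
     (if p = \<infinity> then infnorm v
      else (\<Sum>i\<in>UNIV. \<bar>v $ i\<bar> powr real_of_ereal p) powr (1 / real_of_ereal p))"

definition perturbations :: "ereal \<Rightarrow> real \<Rightarrow> (real ^ 'd) set" where
  "perturbations p \<epsilon> = {\<delta>. lp_norm p \<delta> \<le> \<epsilon>}"

end

theory Submission
  imports Defs
begin

text \<open>Softmax is a Gibbs distribution whose log-partition function is minus the marginal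
  energy, so log-probabilities are differences of energies (\<open>ln_class_prob\<close>). The
  log-ratio in the KL sum is therefore a gap of joint energies plus a constant independent of the
  class, and averaging leaves that constant unchanged.\<close>

lemma ln_class_prob: "ln (class_prob f x y) = marginal_energy f x - joint_energy f x y"
proof -
  have "(\<Sum>k\<in>UNIV. exp (f x $ k)) > 0"
    by (intro sum_pos) auto
  then show ?thesis
    by (simp add: class_prob_def marginal_energy_def joint_energy_def ln_div)
qed

theorem proposition1:
  fixes f :: "real ^ 'd \<Rightarrow> real ^ 'k"
    and x \<delta> x' :: "real ^ 'd"
    and p :: ereal and \<epsilon> :: real
  assumes "1 \<le> p"
    and "\<delta> \<in> perturbations p \<epsilon>"
    and "x' = x + \<delta>"
  shows "KL_div (class_prob f x) (class_prob f x') =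
    class_expectation (class_prob f x) (\<lambda>k. joint_energy f x' k - joint_energy f x k)
      + marginal_energy f x - marginal_energy f x'"
proof -
  let ?P = "class_prob f x" and ?c = "marginal_energy f x - marginal_energy f x'"
  \<comment> \<open>Both probabilities are positive, so the logarithm of the ratio splits;
    \<open>?c\<close> collects the terms free of \<open>k\<close>.\<close>
  have "ln (?P k / class_prob f x' k) = (joint_energy f x' k - joint_energy f x k) + ?c" for k
    using class_prob_pos[of f x k] class_prob_pos[of f x' k]
    by (simp add: ln_div ln_class_prob)
  then have "KL_div ?P (class_prob f x') =
      (\<Sum>k\<in>UNIV. ?P k * (joint_energy f x' k - joint_energy f x k) + ?P k * ?c)"
    by (simp only: KL_div_def distrib_left)
  also have "\<dots> = class_expectation ?P (\<lambda>k. joint_energy f x' k - joint_energy f x k)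
      + (\<Sum>k\<in>UNIV. ?P k) * ?c"
    by (simp only: class_expectation_def sum.distrib sum_distrib_right)
  \<comment> \<open>The weights \<open>?P k\<close> have total mass 1, so \<open>?c\<close> survives
    with coefficient 1.\<close>
  finally show ?thesis
    by (simp add: sum_class_prob)
qed

end
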